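(* Let $\rho\in\mathcal{P}$. The set of all shape descriptors equivalent to $\rho$ is given, according to the location of $\rho$ in $\mathcal{P}$, as follows: 1. if $|\rho|>1$ and $|\mathrm{Re}(\rho)|<1/2$: $\{\rho\}$; 2. if $\mathrm{Re}(\rho)=-1/2$ and $|\rho|>1$: $\{\rho,\,T\rho\}$; 3. if $\mathrm{Re}(\rho)=1/2$ and $|\rho|>1$: $\{\rho,\,T^{-1}\rho\}$; 4. if $|\rho|=1$ and $0\le|\mathrm{Re}(\rho)|<1/2$: $\{\rho,\,S\rho\}$; 5. if $\rho=e^{i2\pi/3}$: $\{\rho,\ S\rho,\ T\rho,\ T^{-1}S\rho,\ ST\rho,\ TST\rho\}$; 6. if $\rho=e^{i\pi/3}$: $\{\rho,\ S\rho,\ T^{-1}\rho,\ TS\rho,\ ST^{-1}\rho,\ STS\rho\}$.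
   Context: The set of shape descriptors is $$\mathcal{P}=\{z\in\mathbb{C} : |z|\ge 1,\ |\mathrm{Re}(z)|\le \tfrac12,\ \mathrm{Im}(z)>0\}.$$ Two shape descriptors $\rho,\rho'\in\mathcal{P}$ are equivalent if there exist $k_1,k_2,k_3,k_4\in\mathbb{Z}$ with $k_1k_4-k_2k_3=1$ such that $\rho'=\dfrac{k_3+k_4\rho}{k_1+k_2\rho}$, i.e. they lie in the same orbit of the modular group $\Gamma$ acting on the upper half plane $\mathcal{H}=\{z\in\mathbb{C}:\mathrm{Im}(z)>0\}$. The transformations $T,S:\mathcal{H}\to\mathcal{H}$ are $T:z\mapsto z+1$ and $S:z\mapsto -1/z$; products denote composition (rightmost applied first). The listed elements of a set are not required to be pairwise distinct. *)

theory Defs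
  imports Complex_Main
begin

definition upper_half_plane :: "complex set" where
  "upper_half_plane = {z. Im z > 0}"

definition shape_descriptors :: "complex set" where
  "shape_descriptors = {z. cmod z \<ge> 1 \<and> \<bar>Re z\<bar> \<le> 1 / 2 \<and> Im z > 0}"

text \<open>
  The denominator never vanishes for \<open>Im \<rho> > 0\<close>, since the determinant
  condition excludes \<open>k1 = k2 = 0\<close>; so totalised division plays no role.
\<close>

definition shape_equiv :: "complex \<Rightarrow> complex \<Rightarrow> bool" where
  "shape_equiv \<rho> \<rho>' \<longleftrightarrow>
     (\<exists>k1 k2 k3 k4 :: int. k1 * k4 - k2 * k3 = 1 \<and>
        \<rho>' = (of_int k3 + of_int k4 * \<rho>) / (of_int k1 + of_int k2 * \<rho>))"

text \<open>
  The transformations of the upper half plane are represented by total functions on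
  \<open>complex\<close>; only their values on the upper half plane matter, and the inverse
  of \<open>T\<close> is the inverse of its restriction to the upper half plane.
\<close>

definition T :: "complex \<Rightarrow> complex" where
  "T z = z + 1"

definition S :: "complex \<Rightarrow> complex" where
  "S z = - 1 / z"

definition T_inv :: "complex \<Rightarrow> complex" where
  "T_inv = inv_into upper_half_plane T"

lemma bij_betw_T: "bij_betw T upper_half_plane upper_half_plane"
  by (rule bij_betw_byWitness[where f' = "\<lambda>z. z - 1"])
    (auto simp: T_def upper_half_plane_def)

lemma S_in_upper_half_plane: "z \<in> upper_half_plane \<Longrightarrow> S z \<in> upper_half_plane"
  by (auto simp: S_def upper_half_plane_def Im_divide intro!: divide_pos_pos add_nonneg_pos)

end

theory Submission
  imports Defs
begin

text \<open>
  If \<open>\<rho>' = (k3 + k4 \<rho>) / (k1 + k2 \<rho>)\<close> with both points in the fundamental domain, then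
  \<open>Im \<rho>' = Im \<rho> / |k1 + k2 \<rho>|\<^sup>2\<close>, and \<open>|k1 + k2 \<rho>|\<^sup>2 \<ge> 1 + k2\<^sup>2 (|\<rho>|\<^sup>2 - 1) \<ge> 1\<close>.
  Applying this to the inverse transformation as well gives \<open>Im \<rho>' = Im \<rho>\<close>, and
  \<open>|\<rho>| = |\<rho>'| = 1\<close> unless \<open>k2 = 0\<close>, in which case \<open>\<rho>' - \<rho>\<close> is an integer. Either way
  \<open>\<rho>'\<close> is \<open>\<rho>\<close> or its mirror image \<open>- cnj \<rho>\<close>, and the latter needs \<open>\<rho>\<close> to lie on the boundary.
  There \<open>S\<close>, \<open>T\<close> and \<open>T_inv\<close> act as this reflection, so all the listed words reduce to these
  two points.
\<close>

text \<open>Rewritten as \<open>(|a| - |b|)^2 + |a| * |b|\<close>, the form contains a positive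
  product when neither entry vanishes; otherwise it is a sum of two squares that are not both
  zero.\<close>

lemma one_le_int_quadratic_form:
  fixes a b :: int
  assumes "a \<noteq> 0 \<or> b \<noteq> 0"
  shows "1 \<le> a\<^sup>2 - \<bar>a * b\<bar> + b\<^sup>2"
proof -
  have eq: "a\<^sup>2 - \<bar>a * b\<bar> + b\<^sup>2 = (\<bar>a\<bar> - \<bar>b\<bar>)\<^sup>2 + \<bar>a\<bar> * \<bar>b\<bar>"
    by (simp add: power2_eq_square algebra_simps abs_mult)
  show ?thesis
  proof (cases "a = 0 \<or> b = 0")
    case True
    then have "a\<^sup>2 - \<bar>a * b\<bar> + b\<^sup>2 = a\<^sup>2 + b\<^sup>2" by auto
    moreover have "a\<^sup>2 + b\<^sup>2 > 0"
      using assms by (simp add: sum_power2_gt_zero_iff)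
    ultimately show ?thesis by linarith
  next
    case False
    then have "\<bar>a\<bar> * \<bar>b\<bar> > 0" by simp
    moreover have "(\<bar>a\<bar> - \<bar>b\<bar>)\<^sup>2 \<ge> 0" by simp
    ultimately show ?thesis unfolding eq by linarith
  qed
qed

text \<open>Expanding the square gives the cross term \<open>2 a b Re z\<close>, which is at least
  \<open>- |a b|\<close> because \<open>|2 Re z| \<le> 1\<close>; the preceding quadratic form
  absorbs it. The excess \<open>b^2 (|z|^2 - 1)\<close> is kept because its vanishing later forces
  \<open>|z| = 1\<close>.\<close>

lemma cmod_denominator_ge:
  fixes a b :: int
  assumes "z \<in> shape_descriptors" "a \<noteq> 0 \<or> b \<noteq> 0"
  shows "1 + (of_int b)\<^sup>2 * ((cmod z)\<^sup>2 - 1) \<le> (cmod (of_int a + of_int b * z))\<^sup>2"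
proof -
  have "(1::real) \<le> of_int (a\<^sup>2 - \<bar>a * b\<bar> + b\<^sup>2)"
    using one_le_int_quadratic_form[OF assms(2)] by (simp only: of_int_1_le_iff)
  then have one_le: "1 \<le> (of_int a)\<^sup>2 - \<bar>of_int (a * b)\<bar> + (of_int b :: real)\<^sup>2"
    by simp
  have "\<bar>2 * Re z\<bar> \<le> 1"
    using assms(1) by (auto simp: shape_descriptors_def)
  then have "\<bar>of_int (a * b) * (2 * Re z)\<bar> \<le> \<bar>of_int (a * b)\<bar>"
    unfolding abs_mult[of "of_int (a * b)"] by (intro mult_left_le) auto
  then have cross: "- \<bar>of_int (a * b)\<bar> \<le> of_int (a * b) * (2 * Re z)"
    by linarith
  have "(cmod (of_int a + of_int b * z))\<^sup>2
      = (of_int a)\<^sup>2 + of_int (a * b) * (2 * Re z) + (of_int b)\<^sup>2 * (cmod z)\<^sup>2"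
    unfolding cmod_power2 by (simp add: power2_eq_square algebra_simps)
  with one_le cross show ?thesis
    by (simp add: algebra_simps)
qed

lemma moebius_denominator_nonzero:
  fixes a b :: int
  assumes "Im z > 0" "a \<noteq> 0 \<or> b \<noteq> 0"
  shows "of_int a + of_int b * z \<noteq> 0"
  using assms by (auto simp: complex_eq_iff)

text \<open>Expanding the fraction by the conjugate of its denominator makes the denominator real;
  the new numerator has imaginary part determinant times \<open>Im z\<close>.\<close>

lemma Im_moebius:
  fixes a b c d :: int
  assumes "a * d - b * c = 1" "of_int a + of_int b * z \<noteq> 0"
    and "w = (of_int c + of_int d * z) / (of_int a + of_int b * z)"
  shows "Im w * (cmod (of_int a + of_int b * z))\<^sup>2 = Im z"
proof -
  let ?q = "of_int a + of_int b * z"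
  have det: "of_int a * of_int d - of_int b * of_int c = (1::real)"
    using assms(1) by (metis of_int_1 of_int_diff of_int_mult)
  have "w * of_real ((cmod ?q)\<^sup>2) = (of_int c + of_int d * z) * cnj ?q"
    unfolding complex_norm_square assms(3) using assms(2) by simp
  then have "Im (w * of_real ((cmod ?q)\<^sup>2)) = Im ((of_int c + of_int d * z) * cnj ?q)"
    by simp
  moreover have "Im (w * of_real ((cmod ?q)\<^sup>2)) = Im w * (cmod ?q)\<^sup>2"
    by simp
  moreover have "Im ((of_int c + of_int d * z) * cnj ?q)
      = (of_int a * of_int d - of_int b * of_int c) * Im z"
    by (simp add: algebra_simps)
  ultimately show ?thesis using det by simp
qed

text \<open>One-sided, so that it serves both a transformation and its inverse. In the equality case
  the denominator has modulus exactly 1, which leaves no room for the excess term when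
  \<open>b\<close> is nonzero.\<close>

lemma shape_equiv_Im_le:
  fixes a b c d :: int
  assumes "z \<in> shape_descriptors" "w \<in> shape_descriptors"
    and "a * d - b * c = 1"
    and "w = (of_int c + of_int d * z) / (of_int a + of_int b * z)"
  shows "Im w \<le> Im z" and "Im w = Im z \<Longrightarrow> b \<noteq> 0 \<Longrightarrow> cmod z = 1"
proof -
  let ?n = "(cmod (of_int a + of_int b * z))\<^sup>2"
  have ab: "a \<noteq> 0 \<or> b \<noteq> 0" using assms(3) by auto
  have z: "cmod z \<ge> 1" "Im z > 0" and w: "Im w > 0"
    using assms(1,2) by (auto simp: shape_descriptors_def)
  have Im: "Im w * ?n = Im z"
    by (rule Im_moebius[OF assms(3) moebius_denominator_nonzero[OF z(2) ab] assms(4)])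
  have ge: "1 + (of_int b)\<^sup>2 * ((cmod z)\<^sup>2 - 1) \<le> ?n"
    by (rule cmod_denominator_ge[OF assms(1) ab])
  have sq: "(cmod z)\<^sup>2 \<ge> 1" using z(1) by simp
  then have "0 \<le> (of_int b)\<^sup>2 * ((cmod z)\<^sup>2 - 1)" by simp
  with ge have "1 \<le> ?n" by linarith
  with w have "Im w * 1 \<le> Im w * ?n" by (intro mult_left_mono) auto
  with Im show "Im w \<le> Im z" by simp
  assume "Im w = Im z" "b \<noteq> 0"
  with Im w have "?n = 1" by simp
  with ge have "(of_int b)\<^sup>2 * ((cmod z)\<^sup>2 - 1) \<le> 0" by simp
  moreover have "(of_int b :: real)\<^sup>2 > 0" using \<open>b \<noteq> 0\<close> by simp
  ultimately have "(cmod z)\<^sup>2 \<le> 1" by (simp add: mult_le_0_iff)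
  with z(1) show "cmod z = 1" by (simp add: power_le_one_iff)
qed

lemma shape_equiv_imp:
  assumes "z \<in> shape_descriptors" "w \<in> shape_descriptors" "shape_equiv z w"
  shows "w = z \<or> w = - cnj z \<and> (\<bar>Re z\<bar> = 1 / 2 \<or> cmod z = 1)"
proof -
  obtain a b c d :: int where det: "a * d - b * c = 1"
    and w: "w = (of_int c + of_int d * z) / (of_int a + of_int b * z)"
    using assms(3) unfolding shape_equiv_def by blast
  have Im_pos: "Im z > 0" "Im w > 0"
    and Re_le: "\<bar>Re z\<bar> \<le> 1 / 2" "\<bar>Re w\<bar> \<le> 1 / 2"
    using assms(1,2) by (auto simp: shape_descriptors_def)
  have ab: "a \<noteq> 0 \<or> b \<noteq> 0" and db: "d \<noteq> 0 \<or> - b \<noteq> 0"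
    using det by auto
  have den: "of_int a + of_int b * z \<noteq> 0"
    by (rule moebius_denominator_nonzero[OF Im_pos(1) ab])
  have den': "of_int d + of_int (- b) * w \<noteq> 0"
    by (rule moebius_denominator_nonzero[OF Im_pos(2) db])
  \<comment> \<open>These are the coefficients of the inverse matrix. Its entry \<open>- b\<close>
    vanishes exactly when \<open>b\<close> does, so the equality case applies to \<open>z\<close>
    and \<open>w\<close> together.\<close>
  have det': "d * a - (- b) * (- c) = 1" using det by (simp add: mult.commute)
  have "w * (of_int a + of_int b * z) = of_int c + of_int d * z"
    using w den by simp
  then have "z * (of_int d + of_int (- b) * w) = of_int (- c) + of_int a * w"
    by (simp add: algebra_simps)
  then have z: "z = (of_int (- c) + of_int a * w) / (of_int d + of_int (- b) * w)"
    using den' by (simp add: eq_divide_eq)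
  note forward = shape_equiv_Im_le[OF assms(1,2) det w]
  note backward = shape_equiv_Im_le[OF assms(2,1) det' z]
  have Im_eq: "Im w = Im z" using forward(1) backward(1) by linarith
  show ?thesis
  proof (cases "b = 0")
    case True
    then have ad: "a * d = 1" using det by simp
    \<comment> \<open>Here \<open>a = d\<close> is 1 or -1, so dividing by \<open>a\<close> is the
      same as multiplying by it.\<close>
    have "w = z + of_int (a * c)"
    proof -
      have "a = 1 \<and> d = 1 \<or> a = - 1 \<and> d = - 1"
        using ad by (simp add: zmult_eq_1_iff)
      then show ?thesis using w True by auto
    qed
    then have Re_w: "Re w = Re z + of_int (a * c)" by simp
    then have "\<bar>of_int (a * c) :: real\<bar> \<le> 1" using Re_le by linarith
    then have "\<bar>a * c\<bar> \<le> 1" by linarith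
    then consider "a * c = 0" | "a * c = 1" | "a * c = - 1" by linarith
    then show ?thesis
    proof cases
      case 1
      then have "w = z" using Re_w Im_eq by (simp add: complex_eq_iff)
      then show ?thesis ..
    next
      case 2
      \<comment> \<open>The strip has width 1, so a shift by 1 goes from its left edge to its right
        edge; at equal height this is the reflection.\<close>
      then have "Re z = - (1 / 2)" "Re w = 1 / 2" using Re_w Re_le by auto
      then show ?thesis using Im_eq by (simp add: complex_eq_iff)
    next
      case 3
      then have "Re z = 1 / 2" "Re w = - (1 / 2)" using Re_w Re_le by auto
      then show ?thesis using Im_eq by (simp add: complex_eq_iff)
    qed
  next
    case False
    then have norms: "cmod z = 1" "cmod w = 1"
      using forward(2) backward(2) Im_eq by auto
    \<comment> \<open>With equal imaginary parts, equal moduli leave only the sign of the real part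
      open.\<close>
    then have "(cmod w)\<^sup>2 = (cmod z)\<^sup>2" by simp
    then have "(Re w)\<^sup>2 = (Re z)\<^sup>2" using Im_eq by (simp add: cmod_power2)
    then have "Re w = Re z \<or> Re w = - Re z" by (simp add: power2_eq_iff)
    then show ?thesis using Im_eq norms by (auto simp: complex_eq_iff)
  qed
qed

lemma shape_equiv_refl: "shape_equiv z z"
  unfolding shape_equiv_def
  by (rule exI[of _ 1], rule exI[of _ 0], rule exI[of _ 0], rule exI[of _ 1]) simp

lemma shape_equiv_T: "shape_equiv z (T z)"
  unfolding shape_equiv_def T_def
  by (rule exI[of _ 1], rule exI[of _ 0], rule exI[of _ 1], rule exI[of _ 1]) simp

lemma shape_equiv_minus_one: "shape_equiv z (z - 1)"
  unfolding shape_equiv_def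
  by (rule exI[of _ 1], rule exI[of _ 0], rule exI[of _ "- 1"], rule exI[of _ 1]) simp

lemma shape_equiv_S: "shape_equiv z (S z)"
  unfolding shape_equiv_def S_def
  by (rule exI[of _ 0], rule exI[of _ 1], rule exI[of _ "- 1"], rule exI[of _ 0]) simp

lemma T_inv_eq:
  assumes "Im z > 0"
  shows "T_inv z = z - 1"
  unfolding T_inv_def
proof (rule inv_into_f_eq)
  show "inj_on T upper_half_plane" using bij_betw_T by (rule bij_betw_imp_inj_on)
  show "z - 1 \<in> upper_half_plane" using assms by (simp add: upper_half_plane_def)
  show "T (z - 1) = z" by (simp add: T_def)
qed

lemma T_eq_reflection: "Re z = - 1 / 2 \<Longrightarrow> T z = - cnj z"
  by (simp add: T_def complex_eq_iff)

lemma T_inv_eq_reflection: "Im z > 0 \<Longrightarrow> Re z = 1 / 2 \<Longrightarrow> T_inv z = - cnj z"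
  by (simp add: T_inv_eq complex_eq_iff)

text \<open>On the unit circle the reciprocal is the conjugate.\<close>

lemma S_eq_reflection:
  assumes "cmod z = 1"
  shows "S z = - cnj z"
proof -
  have "z \<noteq> 0" using assms by auto
  moreover have "z * cnj z = 1" using assms by (simp add: complex_norm_square[symmetric])
  ultimately show ?thesis by (simp add: S_def field_simps)
qed

text \<open>All six cases are read off from this dichotomy. Each boundary condition provides a shift
  by 1 or -1, or \<open>S\<close>, that realises the reflection, and the reflection preserves the
  domain.\<close>

lemma shape_equiv_class:
  assumes "z \<in> shape_descriptors"
  shows "{w \<in> shape_descriptors. shape_equiv z w} =
    (if \<bar>Re z\<bar> = 1 / 2 \<or> cmod z = 1 then {z, - cnj z} else {z})"
proof -
  have "Im z > 0" using assms by (simp add: shape_descriptors_def)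
  have mem: "- cnj z \<in> shape_descriptors"
    using assms by (simp add: shape_descriptors_def)
  have "shape_equiv z (- cnj z)" if boundary: "\<bar>Re z\<bar> = 1 / 2 \<or> cmod z = 1"
  proof -
    consider "Re z = - 1 / 2" | "Re z = 1 / 2" | "cmod z = 1"
      using boundary by linarith
    then show ?thesis
    proof cases
      case 1
      then show ?thesis using shape_equiv_T[of z] by (simp add: T_eq_reflection)
    next
      case 2
      then have "z - 1 = - cnj z" by (simp add: complex_eq_iff)
      then show ?thesis using shape_equiv_minus_one[of z] by simp
    next
      case 3
      then show ?thesis using shape_equiv_S[of z] by (simp add: S_eq_reflection)
    qed
  qed
  then show ?thesis
    using assms mem shape_equiv_imp[OF assms] shape_equiv_refl[of z] by auto
qed

theorem proposition3p4:
  fixes \<rho> :: complex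
  assumes "\<rho> \<in> shape_descriptors"
  shows
    "(cmod \<rho> > 1 \<and> \<bar>Re \<rho>\<bar> < 1 / 2 \<longrightarrow>
        {\<rho>' \<in> shape_descriptors. shape_equiv \<rho> \<rho>'} = {\<rho>}) \<and>
     (Re \<rho> = - 1 / 2 \<and> cmod \<rho> > 1 \<longrightarrow>
        {\<rho>' \<in> shape_descriptors. shape_equiv \<rho> \<rho>'} = {\<rho>, T \<rho>}) \<and>
     (Re \<rho> = 1 / 2 \<and> cmod \<rho> > 1 \<longrightarrow>
        {\<rho>' \<in> shape_descriptors. shape_equiv \<rho> \<rho>'} = {\<rho>, T_inv \<rho>}) \<and>
     (cmod \<rho> = 1 \<and> 0 \<le> \<bar>Re \<rho>\<bar> \<and> \<bar>Re \<rho>\<bar> < 1 / 2 \<longrightarrow>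
        {\<rho>' \<in> shape_descriptors. shape_equiv \<rho> \<rho>'} = {\<rho>, S \<rho>}) \<and>
     (\<rho> = exp (\<i> * (2 * of_real pi / 3)) \<longrightarrow>
        {\<rho>' \<in> shape_descriptors. shape_equiv \<rho> \<rho>'} =
          {\<rho>, S \<rho>, T \<rho>, (T_inv \<circ> S) \<rho>, (S \<circ> T) \<rho>, (T \<circ> S \<circ> T) \<rho>}) \<and>
     (\<rho> = exp (\<i> * (of_real pi / 3)) \<longrightarrow>
        {\<rho>' \<in> shape_descriptors. shape_equiv \<rho> \<rho>'} =
          {\<rho>, S \<rho>, T_inv \<rho>, (T \<circ> S) \<rho>, (S \<circ> T_inv) \<rho>, (S \<circ> T \<circ> S) \<rho>})"
proof -
  have Im_pos: "Im \<rho> > 0" using assms by (simp add: shape_descriptors_def)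
  note cls = shape_equiv_class[OF assms]
  \<comment> \<open>At this corner \<open>S\<close> and \<open>T\<close> both reflect, and at its
    mirror image \<open>S\<close> and \<open>T_inv\<close> reflect back. Each word thus alternates
    between the two corners, and the parity of its length decides where it ends.\<close>
  have case5: "{\<rho>, S \<rho>, T \<rho>, (T_inv \<circ> S) \<rho>, (S \<circ> T) \<rho>, (T \<circ> S \<circ> T) \<rho>} = {\<rho>, - cnj \<rho>}"
    if "Re \<rho> = - 1 / 2" "cmod \<rho> = 1"
    using that Im_pos by (simp add: S_eq_reflection T_eq_reflection T_inv_eq_reflection insert_commute)
  \<comment> \<open>The mirrored situation: \<open>T_inv\<close> now leaves the corner and
    \<open>T\<close> returns to it.\<close>
  have case6: "{\<rho>, S \<rho>, T_inv \<rho>, (T \<circ> S) \<rho>, (S \<circ> T_inv) \<rho>, (S \<circ> T \<circ> S) \<rho>} = {\<rho>, - cnj \<rho>}"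
    if "Re \<rho> = 1 / 2" "cmod \<rho> = 1"
    using that Im_pos by (simp add: S_eq_reflection T_eq_reflection T_inv_eq_reflection insert_commute)
  have exp5: "Re \<rho> = - 1 / 2 \<and> cmod \<rho> = 1" if "\<rho> = exp (\<i> * (2 * of_real pi / 3))"
  proof -
    have "\<rho> = cis (2 * pi / 3)" using that by (simp add: cis_conv_exp)
    then show ?thesis using cos_120 by simp
  qed
  have exp6: "Re \<rho> = 1 / 2 \<and> cmod \<rho> = 1" if "\<rho> = exp (\<i> * (of_real pi / 3))"
  proof -
    have "\<rho> = cis (pi / 3)" using that by (simp add: cis_conv_exp)
    then show ?thesis using cos_60 by simp
  qed
  show ?thesis
  proof (intro conjI impI)
    assume "\<rho> = exp (\<i> * (2 * of_real pi / 3))"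
    then have "Re \<rho> = - 1 / 2" "cmod \<rho> = 1" using exp5 by auto
    then show "{\<rho>' \<in> shape_descriptors. shape_equiv \<rho> \<rho>'} =
          {\<rho>, S \<rho>, T \<rho>, (T_inv \<circ> S) \<rho>, (S \<circ> T) \<rho>, (T \<circ> S \<circ> T) \<rho>}"
      unfolding cls using case5 by simp
  next
    assume "\<rho> = exp (\<i> * (of_real pi / 3))"
    then have "Re \<rho> = 1 / 2" "cmod \<rho> = 1" using exp6 by auto
    then show "{\<rho>' \<in> shape_descriptors. shape_equiv \<rho> \<rho>'} =
          {\<rho>, S \<rho>, T_inv \<rho>, (T \<circ> S) \<rho>, (S \<circ> T_inv) \<rho>, (S \<circ> T \<circ> S) \<rho>}"
      unfolding cls using case6 by simp
  \<comment> \<open>In the other four cases the hypotheses decide the conditional in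
    \<open>cls\<close>, and at most one generator has to be identified with the reflection.\<close>
  qed (use Im_pos in \<open>auto simp: cls T_eq_reflection T_inv_eq_reflection S_eq_reflection\<close>)
qed

end
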